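(* Let $n\ge1$ be an integer, $0\leq\alpha<1$, $\lambda>0$, and let $g$ be analytic in $\mathbb{D}$. If $|g(z)|<\delta$ for all $z\in\mathbb{D}$, where $\delta$ is the smallest positive root of $$\phi(r):=(1+n)\bigl(2\alpha n-\lambda(n+1)-n\bigr)r^2+n(1-\alpha+n)\bigl(2\lambda(n+1)+n+\alpha n^2\bigr)r-\lambda n^2(n+1-\alpha)^2,$$ then the function $$f(z)=z+z^{n+1}\int_0^1\int_0^1 g(rsz)\,r^{n-\alpha}s^{n-1}\,dr\,ds$$ belongs to $G_{\lambda,\alpha}$.
   Context: $\mathbb{D}=\{z\in\mathbb{C}:|z|<1\}$. $\mathcal{A}$ is the class of analytic functions $f$ on $\mathbb{D}$ with $f(0)=0$, $f'(0)=1$. For $0\le\alpha\le1$ and $\lambda>0$, $$G_{\lambda,\alpha}=\left\{f\in\mathcal{A}:\left|\frac{1-\alpha+\alpha zf''(z)/f'(z)}{zf'(z)/f(z)}-(1-\alpha)\right|<\lambda,\ z\in\mathbb{D}\right\},$$ where expressions such as $zf'(z)/f(z)$ are given their limiting values at $z=0$. *)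

theory Defs
  imports "HOL-Complex_Analysis.Complex_Analysis"
begin

abbreviation unit_disc :: "complex set" ("\<D>")
  where "\<D> \<equiv> ball 0 1"

definition class_A :: "(complex \<Rightarrow> complex) set"
  where "class_A = {f. f holomorphic_on \<D> \<and> f 0 = 0 \<and> deriv f 0 = 1}"

(* z f'(z) / f(z), with its limiting value at z = 0. *)
definition log_deriv_quot :: "(complex \<Rightarrow> complex) \<Rightarrow> complex \<Rightarrow> complex"
  where "log_deriv_quot f z =
    (if z = 0 then Lim (at 0) (\<lambda>w. w * deriv f w / f w) else z * deriv f z / f z)"

lemma log_deriv_quot_0:
  assumes "f \<in> class_A"
  shows "log_deriv_quot f 0 = 1"
proof -
  have hol: "f holomorphic_on \<D>" and f0: "f 0 = 0" and f1: "deriv f 0 = 1"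
    using assms by (auto simp: class_A_def)
  have "(f has_field_derivative 1) (at 0)"
    using holomorphic_derivI[OF hol open_ball, of 0] f1 by simp
  then have 1: "(\<lambda>w. f w / w) \<midarrow>0\<rightarrow> 1"
    using f0 by (simp add: has_field_derivative_iff)
  have "continuous_on \<D> (deriv f)"
    by (intro holomorphic_on_imp_continuous_on holomorphic_deriv hol open_ball)
  then have "isCont (deriv f) 0"
    by (simp add: continuous_on_eq_continuous_at)
  then have 2: "deriv f \<midarrow>0\<rightarrow> 1"
    using f1 by (simp add: isCont_def)
  have "(\<lambda>w. deriv f w / (f w / w)) \<midarrow>0\<rightarrow> 1 / 1"
    by (intro tendsto_divide 1 2) simp
  then have "(\<lambda>w. w * deriv f w / f w) \<midarrow>0\<rightarrow> 1"
    by (simp add: mult.commute)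
  then show ?thesis
    unfolding log_deriv_quot_def by (simp add: tendsto_Lim)
qed

(* Division by zero is 0 in HOL, so the requirement that the quotients
   z f'' / f' and z f' / f be defined throughout the disc is explicit. *)
definition class_G :: "real \<Rightarrow> real \<Rightarrow> (complex \<Rightarrow> complex) set"
  where "class_G lam \<alpha> = {f \<in> class_A.
    (\<forall>z\<in>\<D>. deriv f z \<noteq> 0) \<and>
    (\<forall>z\<in>\<D> - {0}. f z \<noteq> 0) \<and>
    (\<forall>z\<in>\<D>. cmod ((1 - of_real \<alpha> + of_real \<alpha> * (z * deriv (deriv f) z / deriv f z))
                    / log_deriv_quot f z - (1 - of_real \<alpha>)) < lam)}"

definition phi :: "nat \<Rightarrow> real \<Rightarrow> real \<Rightarrow> real \<Rightarrow> real"
  where "phi n \<alpha> lam r =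
    (1 + real n) * (2 * \<alpha> * real n - lam * (real n + 1) - real n) * r\<^sup>2
    + real n * (1 - \<alpha> + real n) * (2 * lam * (real n + 1) + real n + \<alpha> * (real n)\<^sup>2) * r
    - lam * (real n)\<^sup>2 * (real n + 1 - \<alpha>)\<^sup>2"

definition smallest_positive_root :: "(real \<Rightarrow> real) \<Rightarrow> real \<Rightarrow> bool"
  where "smallest_positive_root p \<delta> \<longleftrightarrow>
    0 < \<delta> \<and> p \<delta> = 0 \<and> (\<forall>r. 0 < r \<and> p r = 0 \<longrightarrow> \<delta> \<le> r)"

lemma phi_smallest_positive_root_exists:
  assumes "n \<ge> 1" "0 \<le> \<alpha>" "\<alpha> < 1" "0 < lam"
  shows "\<exists>\<delta>. smallest_positive_root (phi n \<alpha> lam) \<delta>"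
proof -
  define c where "c = real n * (real n + 1 - \<alpha>)"
  define R where "R = c / (real n + 1)"
  have n: "real n > 0" using assms by simp
  have c: "c > 0" using assms n by (simp add: c_def)
  have R: "R > 0" using c by (simp add: R_def)
  have cR: "c = R * (real n + 1)" by (simp add: R_def)
  have phi: "phi n \<alpha> lam r =
    (1 + real n) * (2 * \<alpha> * real n - lam * (real n + 1) - real n) * r\<^sup>2
    + c * (2 * lam * (real n + 1) + real n + \<alpha> * (real n)\<^sup>2) * r - lam * c\<^sup>2" for r
    by (simp add: phi_def c_def algebra_simps power2_eq_square)
  have "phi n \<alpha> lam R = R\<^sup>2 * (real n + 1) * \<alpha> * real n * (real n + 2)"
    unfolding phi cR by (simp add: algebra_simps power2_eq_square)
  then have pR: "phi n \<alpha> lam R \<ge> 0" using assms by simp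
  have p0: "phi n \<alpha> lam 0 < 0" using assms c by (simp add: phi)
  have cont: "continuous_on UNIV (phi n \<alpha> lam)"
    unfolding phi_def by (intro continuous_intros)
  define S where "S = {0..R} \<inter> phi n \<alpha> lam -` {0}"
  have "compact S" unfolding S_def
    by (intro compact_Int_closed continuous_closed_vimage) 
       (use cont in \<open>auto simp: continuous_on_eq_continuous_at\<close>)
  moreover have "S \<noteq> {}"
    using IVT'[of "phi n \<alpha> lam" 0 0 R] pR p0 R continuous_on_subset[OF cont]
    by (auto simp: S_def)
  ultimately obtain d where d: "d \<in> S" "\<forall>t\<in>S. d \<le> t"
    using compact_attains_inf by blast
  have "d \<noteq> 0" using d p0 by (auto simp: S_def)
  moreover have "d \<le> r" if "0 < r" "phi n \<alpha> lam r = 0" for r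
    using that d by (cases "r \<le> R") (auto simp: S_def)
  ultimately have "smallest_positive_root (phi n \<alpha> lam) d"
    using d by (auto simp: smallest_positive_root_def S_def)
  then show ?thesis ..
qed

end

theory Submission
  imports Defs
begin

text \<open>
  Let \<open>H(z) = \<integral> g(r z) r\<^sup>n\<^sup>-\<^sup>\<alpha> dr\<close>, \<open>L(z) = \<integral> H(s z) s\<^sup>n\<^sup>-\<^sup>1 ds\<close>, both over \<open>[0, 1]\<close>, so that \<open>f = z F\<close> with
  \<open>F = 1 + z\<^sup>n L\<close>. Integration by parts gives \<open>z L' + n L = H\<close> and \<open>z H' + (n + 1 - \<alpha>) H = g\<close>, hence
  \<open>f' = P := 1 + z\<^sup>n (L + H)\<close> and \<open>z f'' = T := z\<^sup>n (\<alpha> H + g)\<close>. If \<open>\<bar>g\<bar> \<le> n (n + 1 - \<alpha>) y\<close> on the closed disc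
  of radius \<open>\<bar>z\<bar>\<close>, then at \<open>z\<close> the moduli of \<open>F - 1\<close>, \<open>F - P\<close>, \<open>P - 1\<close>, \<open>T\<close> are at most
  \<open>y\<close>, \<open>n y\<close>, \<open>(n + 1) y\<close>, \<open>n (n + 1) y\<close>. The expression defining the class equals
  \<open>(1 - \<alpha>) (F - P) / P + \<alpha> F T / P\<^sup>2\<close>, and bounding it termwise by these moduli yields a value below
  \<open>\<lambda>\<close> exactly when \<open>\<phi>(n (n + 1 - \<alpha>) y) < 0\<close>.
\<close>

section \<open>Weighted averages along radii\<close>

text \<open>The conditions force \<open>k r = r powr (b - 1)\<close> for
  \<open>0 < r \<le> 1\<close>. The abstract form treats \<open>r powr (real n - \<alpha>)\<close>
  and \<open>s ^ (n - 1)\<close> alike. For \<open>n = 1\<close> the latter is constantly 1, whereas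
  \<open>0 powr 0 = 0\<close> would break continuity at 0.\<close>

definition radial_weight :: "(real \<Rightarrow> real) \<Rightarrow> real \<Rightarrow> bool"
  where "radial_weight k b \<longleftrightarrow> 0 < b \<and> continuous_on {0..1} k \<and> (\<forall>r\<in>{0..1}. 0 \<le> k r) \<and> k 1 = 1 \<and>
    (\<forall>r\<in>{0<..<1}. ((\<lambda>r. r * k r) has_real_derivative b * k r) (at r))"

definition radial_average :: "(real \<Rightarrow> real) \<Rightarrow> (complex \<Rightarrow> complex) \<Rightarrow> complex \<Rightarrow> complex"
  where "radial_average k g w = integral {0..1} (\<lambda>r. g (of_real r * w) * of_real (k r))"

lemma radial_weight_powr:
  assumes "0 < a"
  shows "radial_weight (\<lambda>r. r powr a) (a + 1)"
proof -
  have "((\<lambda>r. r * r powr a) has_real_derivative (a + 1) * r powr a) (at r)" if "0 < r" for r :: real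
    by (rule derivative_eq_intros refl | use that in \<open>simp add: powr_diff field_simps\<close>)+
  moreover have "continuous_on {0..1} (\<lambda>r::real. r powr a)"
    using assms by (intro continuous_on_powr' continuous_intros) auto
  ultimately show ?thesis
    using assms by (simp add: radial_weight_def)
qed

lemma radial_weight_power: "radial_weight (\<lambda>r. r ^ m) (real m + 1)"
proof -
  have "((\<lambda>r. r * r ^ m) has_real_derivative (real m + 1) * r ^ m) (at r)" for r :: real
    unfolding power_Suc[symmetric] by (rule derivative_eq_intros refl | simp)+
  then show ?thesis
    by (auto simp: radial_weight_def intro!: continuous_intros)
qed

text \<open>The primitive \<open>r * k r\<close> of \<open>b * k r\<close> rises from 0 to 1 on the
  unit interval.\<close>

lemma has_integral_radial_weight:
  assumes "radial_weight k b"
  shows "(k has_integral 1 / b) {0..1}"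
proof -
  have "((\<lambda>r. b * k r) has_integral 1 * k 1 - 0 * k 0) {0..1}"
    using assms
    by (intro fundamental_theorem_of_calculus_interior)
       (auto simp: radial_weight_def has_real_derivative_iff_has_vector_derivative intro!: continuous_intros)
  from has_integral_mult_right[OF this, of "1 / b"] show ?thesis
    using assms by (simp add: radial_weight_def)
qed

lemma of_real_mult_in_cball:
  assumes "w \<in> cball 0 \<rho>" "r \<in> {0..1}"
  shows "of_real r * w \<in> (cball 0 \<rho> :: complex set)"
  using assms mult_mono[of r 1 "cmod w" \<rho>] by (auto simp: norm_mult)

lemma of_real_mult_in_unit_disc:
  assumes "w \<in> \<D>" "r \<in> {0..1}"
  shows "of_real r * w \<in> \<D>"
  using of_real_mult_in_cball[of w "cmod w" r] assms by auto

lemma continuous_on_radial_integrand: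
  fixes g :: "complex \<Rightarrow> complex"
  assumes "radial_weight k b" "continuous_on \<D> g" "w \<in> \<D>"
  shows "continuous_on {0..1} (\<lambda>r. g (of_real r * w) * of_real (k r))"
  using assms(1) of_real_mult_in_unit_disc[OF assms(3)]
  by (intro continuous_intros continuous_on_compose2[OF assms(2)]) (auto simp: radial_weight_def)

text \<open>The average samples \<open>g\<close> only on the segment from 0 to \<open>w\<close>, and
  \<open>k\<close> has total mass \<open>1 / b\<close>. Since hypothesis and conclusion concern the
  same closed disc, the bound can be iterated from \<open>g\<close> to \<open>H\<close> to
  \<open>L\<close>.\<close>

lemma norm_radial_average_le:
  assumes k: "radial_weight k b" and g: "continuous_on \<D> g" and "\<rho> < 1"
    and w: "w \<in> cball 0 \<rho>" and M: "\<And>u. u \<in> cball 0 \<rho> \<Longrightarrow> cmod (g u) \<le> M"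
  shows "cmod (radial_average k g w) \<le> M / b"
proof -
  have "w \<in> \<D>" using w \<open>\<rho> < 1\<close> by auto
  have int: "((\<lambda>r. M * k r) has_integral M * (1 / b)) {0..1}"
    by (intro has_integral_mult_right has_integral_radial_weight k)
  have "cmod (radial_average k g w) \<le> integral {0..1} (\<lambda>r. M * k r)"
    unfolding radial_average_def
  proof (rule Henstock_Kurzweil_Integration.integral_norm_bound_integral)
    show "(\<lambda>r. g (of_real r * w) * of_real (k r)) integrable_on {0..1}"
      by (intro integrable_continuous_real continuous_on_radial_integrand[OF k g \<open>w \<in> \<D>\<close>])
    show "(\<lambda>r. M * k r) integrable_on {0..1}"
      using int by blast
    show "cmod (g (of_real r * w) * of_real (k r)) \<le> M * k r" if "r \<in> {0..1}" for r
      using M[OF of_real_mult_in_cball[OF w that]] k that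
      by (auto simp: norm_mult radial_weight_def intro!: mult_right_mono)
  qed
  also have "\<dots> = M / b"
    using integral_unique[OF int] by simp
  finally show ?thesis .
qed

text \<open>Differentiation under the integral sign, kept explicit so that
  \<open>radial_average_ode\<close> can match the integrand.\<close>

lemma has_field_derivative_radial_average:
  assumes k: "radial_weight k b" and g: "g holomorphic_on \<D>" and w: "w \<in> \<D>"
  shows "(radial_average k g has_field_derivative
           integral {0..1} (\<lambda>r. of_real r * deriv g (of_real r * w) * of_real (k r))) (at w)"
proof -
  have cg: "continuous_on \<D> g" "continuous_on \<D> (deriv g)"
    by (intro holomorphic_on_imp_continuous_on holomorphic_deriv g open_ball)+
  have ck: "continuous_on {0..1} k" using k by (simp add: radial_weight_def)
  have "((\<lambda>w. integral (cbox 0 1) (\<lambda>r. g (of_real r * w) * of_real (k r))) has_field_derivative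
           integral (cbox 0 1) (\<lambda>r. of_real r * deriv g (of_real r * w) * of_real (k r))) (at w within \<D>)"
  proof (rule leibniz_rule_field_derivative)
    fix w and r :: real assume w: "w \<in> \<D>" and r: "r \<in> cbox 0 1"
    then have "of_real r * w \<in> \<D>" using of_real_mult_in_unit_disc by simp
    then have "(g has_field_derivative deriv g (of_real r * w)) (at (of_real r * w))"
      by (rule holomorphic_derivI[OF g open_ball])
    then have "((\<lambda>w. g (of_real r * w)) has_field_derivative deriv g (of_real r * w) * of_real r) (at w within \<D>)"
      by (rule DERIV_chain2) (rule derivative_eq_intros refl | simp)+
    then show "((\<lambda>w. g (of_real r * w) * of_real (k r)) has_field_derivative
        of_real r * deriv g (of_real r * w) * of_real (k r)) (at w within \<D>)"
      by (auto intro!: derivative_eq_intros)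
  next
    fix w assume "w \<in> \<D>"
    then show "(\<lambda>r. g (of_real r * w) * of_real (k r)) integrable_on cbox 0 1"
      using integrable_continuous_real[OF continuous_on_radial_integrand[OF k cg(1)]] by simp
  next
    show "continuous_on (\<D> \<times> cbox 0 1) (\<lambda>(w, r). of_real r * deriv g (of_real r * w) * of_real (k r))"
      unfolding case_prod_unfold using of_real_mult_in_unit_disc
      by (intro continuous_intros continuous_on_compose2[OF cg(2)] continuous_on_compose2[OF ck]) auto
  qed (use w in auto)
  then show ?thesis
    using w by (simp add: radial_average_def[abs_def] at_within_open[OF w open_ball])
qed

lemma holomorphic_radial_average:
  assumes "radial_weight k b" "g holomorphic_on \<D>"
  shows "radial_average k g holomorphic_on \<D>"
  using has_field_derivative_radial_average[OF assms]
  by (meson field_differentiable_at_within field_differentiable_def holomorphic_on_def)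

text \<open>The derivative of \<open>r k(r) g(r w)\<close> in \<open>r\<close> is \<open>k(r) (b g(r w) + r w g'(r w))\<close>; integrate over \<open>[0, 1]\<close>.\<close>
lemma radial_average_ode:
  assumes k: "radial_weight k b" and g: "g holomorphic_on \<D>" and w: "w \<in> \<D>"
  shows "w * deriv (radial_average k g) w + of_real b * radial_average k g w = g w"
proof -
  have cg: "continuous_on \<D> g" "continuous_on \<D> (deriv g)"
    by (intro holomorphic_on_imp_continuous_on holomorphic_deriv g open_ball)+
  have ck: "continuous_on {0..1} k" using k by (simp add: radial_weight_def)
  have "((\<lambda>r. of_real (b * k r) * g (of_real r * w) + of_real (r * k r) * (w * deriv g (of_real r * w)))
      has_integral of_real (1 * k 1) * g (of_real 1 * w) - of_real (0 * k 0) * g (of_real 0 * w)) {0..1}"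
  proof (rule fundamental_theorem_of_calculus_interior)
    show "continuous_on {0..1} (\<lambda>r. of_real (r * k r) * g (of_real r * w))"
      using of_real_mult_in_unit_disc[OF w]
      by (intro continuous_intros ck continuous_on_compose2[OF cg(1)]) auto
    fix r :: real assume r: "r \<in> {0<..<1}"
    have 1: "((\<lambda>r. complex_of_real (r * k r)) has_vector_derivative of_real (b * k r)) (at r)"
      using k r by (intro has_vector_derivative_of_real)
        (simp add: radial_weight_def flip: has_real_derivative_iff_has_vector_derivative)
    have "(g has_field_derivative deriv g (of_real r * w)) (at (of_real r * w))"
      using of_real_mult_in_unit_disc[OF w] r by (intro holomorphic_derivI[OF g open_ball]) auto
    moreover have "((\<lambda>r. of_real r * w) has_vector_derivative w) (at r)"
      by (auto intro!: derivative_eq_intros)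
    ultimately have "((g \<circ> (\<lambda>r. of_real r * w)) has_vector_derivative w * deriv g (of_real r * w)) (at r)"
      by (intro field_vector_diff_chain_at)
    from has_vector_derivative_mult[OF 1 this]
    show "((\<lambda>r. of_real (r * k r) * g (of_real r * w)) has_vector_derivative
       of_real (b * k r) * g (of_real r * w) + of_real (r * k r) * (w * deriv g (of_real r * w))) (at r)"
      by (simp add: o_def add.commute)
  qed simp
  moreover have "k 1 = 1" using k by (simp add: radial_weight_def)
  \<comment> \<open>The same integrand, now integrated term by term; uniqueness of the integral
    gives the equation.\<close>
  moreover have "((\<lambda>r. of_real b * (g (of_real r * w) * of_real (k r)) +
         w * (of_real r * deriv g (of_real r * w) * of_real (k r)))
      has_integral of_real b * radial_average k g w + w * deriv (radial_average k g) w) {0..1}"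
    unfolding radial_average_def[of _ _ w] DERIV_imp_deriv[OF has_field_derivative_radial_average[OF assms]]
    using of_real_mult_in_unit_disc[OF w]
    by (intro has_integral_add has_integral_mult_right integrable_integral integrable_continuous_real
          continuous_on_radial_integrand[OF k cg(1) w] continuous_intros ck continuous_on_compose2[OF cg(2)]) auto
  ultimately show ?thesis
    by (simp add: mult_ac has_integral_iff add.commute)
qed

section \<open>The sign of \<open>phi\<close> below its smallest positive root\<close>

lemma neg_below_smallest_positive_root:
  assumes "smallest_positive_root p \<delta>" "continuous_on UNIV p" "p 0 < 0" "0 \<le> r" "r < \<delta>"
  shows "p r < 0"
proof (rule ccontr)
  assume "\<not> p r < 0"
  then obtain x where "0 \<le> x" "x \<le> r" "p x = 0"
    using IVT'[of p 0 0 r] assms continuous_on_subset[of UNIV p] by auto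
  moreover from this have "x \<noteq> 0" using \<open>p 0 < 0\<close> by auto
  ultimately have "\<delta> \<le> x"
    using assms(1) by (simp add: smallest_positive_root_def)
  then show False
    using \<open>x \<le> r\<close> \<open>r < \<delta>\<close> by simp
qed

text \<open>This explains the shape of \<open>phi\<close>: up to a square factor it is the termwise
  bound minus \<open>lam\<close>, multiplied by the squared lower bound \<open>1 - (n + 1) y\<close>
  for the modulus of \<open>P\<close>.\<close>

lemma phi_scaled:
  "phi n \<alpha> lam (real n * (real n + 1 - \<alpha>) * y) = (real n * (real n + 1 - \<alpha>))\<^sup>2 *
     ((1 - \<alpha>) * (real n * y) * (1 - (real n + 1) * y)
       + \<alpha> * (1 + y) * (real n * (real n + 1) * y) - lam * (1 - (real n + 1) * y)\<^sup>2)"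
  unfolding phi_def by algebra

text \<open>The second claim keeps \<open>P\<close> away from 0. If it failed,
  \<open>1 / (n + 1)\<close> would also lie in the range where \<open>phi\<close> is
  negative.\<close>

lemma phi_neg_imp_lt_one:
  assumes n: "n \<ge> 1" and \<alpha>: "0 \<le> \<alpha>" "\<alpha> < 1" and lam: "lam > 0"
    and root: "smallest_positive_root (phi n \<alpha> lam) \<delta>"
    and y: "0 \<le> y" "real n * (real n + 1 - \<alpha>) * y < \<delta>"
  shows "phi n \<alpha> lam (real n * (real n + 1 - \<alpha>) * y) < 0" "(real n + 1) * y < 1"
proof -
  define c where "c = real n * (real n + 1 - \<alpha>)"
  have c: "c > 0" using n \<alpha> by (auto simp: c_def)
  have cont: "continuous_on UNIV (phi n \<alpha> lam)"
    unfolding phi_def by (intro continuous_intros)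
  have p0: "phi n \<alpha> lam 0 < 0"
    using phi_scaled[of n \<alpha> lam 0] c lam by (simp add: c_def[symmetric])
  have neg: "phi n \<alpha> lam r < 0" if "0 \<le> r" "r < \<delta>" for r
    using neg_below_smallest_positive_root[OF root cont p0 that] .
  show "phi n \<alpha> lam (real n * (real n + 1 - \<alpha>) * y) < 0"
    using c y by (intro neg) (auto simp: c_def[symmetric])
  show "(real n + 1) * y < 1"
  proof (rule ccontr)
    assume "\<not> ?thesis"
    then have "1 / (real n + 1) \<le> y" by (simp add: field_simps)
    then have "c * (1 / (real n + 1)) \<le> c * y" using c by (intro mult_left_mono) auto
    then have "phi n \<alpha> lam (c * (1 / (real n + 1))) < 0"
      using y c by (intro neg) (auto simp: c_def[symmetric])
    \<comment> \<open>At \<open>y = 1 / (n + 1)\<close> every term with the factor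
      \<open>1 - (n + 1) y\<close> vanishes, and only the nonnegative term in
      \<open>\<alpha>\<close> survives.\<close>
    moreover have "phi n \<alpha> lam (c * (1 / (real n + 1))) \<ge> 0"
      unfolding c_def phi_scaled using \<alpha> by (auto intro!: mult_nonneg_nonneg)
    ultimately show False by simp
  qed
qed

section \<open>The pointwise estimate\<close>

lemma class_G_estimate:
  fixes F P T :: complex and m y :: real
  assumes \<alpha>: "0 \<le> \<alpha>" "\<alpha> < 1" and "0 \<le> m" and y: "0 \<le> y" "(m + 1) * y < 1"
    and F: "cmod (F - 1) \<le> y" and FP: "cmod (F - P) \<le> m * y"
    and P: "cmod (P - 1) \<le> (m + 1) * y" and T: "cmod T \<le> m * (m + 1) * y"
    and neg: "(1 - \<alpha>) * (m * y) * (1 - (m + 1) * y) + \<alpha> * (1 + y) * (m * (m + 1) * y)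
                < lam * (1 - (m + 1) * y)\<^sup>2"
  shows "cmod ((1 - of_real \<alpha> + of_real \<alpha> * (T / P)) / (P / F) - (1 - of_real \<alpha>)) < lam"
proof -
  define q where "q = 1 - (m + 1) * y"
  have q: "0 < q" using y by (simp add: q_def)
  have "q \<le> cmod P"
    using P norm_triangle_ineq2[of 1 "1 - P"] by (simp add: q_def norm_minus_commute)
  then have Pq: "q \<le> cmod P" "q\<^sup>2 \<le> (cmod P)\<^sup>2" "P \<noteq> 0"
    using q by (auto intro: power_mono)
  have F1: "cmod F \<le> 1 + y"
    using F norm_triangle_ineq[of 1 "F - 1"] by simp
  \<comment> \<open>The identity holds for \<open>F = 0\<close> too: as division by zero gives 0,
    both sides are then \<open>-(1 - \<alpha>)\<close>.\<close>
  have "(1 - of_real \<alpha> + of_real \<alpha> * (T / P)) / (P / F) - (1 - of_real \<alpha>)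
      = of_real (1 - \<alpha>) * (F - P) / P + of_real \<alpha> * F * T / P\<^sup>2"
    using Pq by (simp add: field_simps power2_eq_square)
  also have "cmod \<dots> \<le> cmod (of_real (1 - \<alpha>) * (F - P) / P) + cmod (of_real \<alpha> * F * T / P\<^sup>2)"
    by (rule norm_triangle_ineq)
  also have "\<dots> = (1 - \<alpha>) * cmod (F - P) / cmod P + \<alpha> * cmod F * cmod T / (cmod P)\<^sup>2"
    using \<alpha> by (simp only: norm_mult norm_divide norm_power norm_of_real abs_of_nonneg)
  also have "\<dots> \<le> (1 - \<alpha>) * (m * y) / q + \<alpha> * (1 + y) * (m * (m + 1) * y) / q\<^sup>2"
    using \<alpha> \<open>0 \<le> m\<close> y Pq q F1 FP T
    by (intro add_mono frac_le mult_mono mult_left_mono mult_nonneg_nonneg) auto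
  also have "\<dots> = ((1 - \<alpha>) * (m * y) * q + \<alpha> * (1 + y) * (m * (m + 1) * y)) / q\<^sup>2"
    using q by (simp add: add_divide_distrib power2_eq_square)
  also have "\<dots> < lam"
    using neg q by (simp add: q_def[symmetric] divide_less_eq)
  finally show ?thesis .
qed

section \<open>Derivatives of \<open>f\<close> and membership in the class\<close>

theorem corollary2p2:
  fixes n :: nat and \<alpha> lam \<delta> :: real and g :: "complex \<Rightarrow> complex"
  assumes "n \<ge> 1" and "0 \<le> \<alpha>" and "\<alpha> < 1" and "lam > 0"
    and "g holomorphic_on \<D>"
    and "smallest_positive_root (phi n \<alpha> lam) \<delta>"
    and "\<And>z. z \<in> \<D> \<Longrightarrow> cmod (g z) < \<delta>"
  shows "(\<lambda>z. z + z ^ (n + 1) *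
           integral {0..1::real} (\<lambda>s. integral {0..1::real} (\<lambda>r.
             g (of_real r * of_real s * z) * of_real (r powr (real n - \<alpha>)) * of_real (s ^ (n - 1)))))
         \<in> class_G lam \<alpha>"
proof -
  define H where "H = radial_average (\<lambda>r. r powr (real n - \<alpha>)) g"
  define L where "L = radial_average (\<lambda>s. s ^ (n - 1)) H"
  define F where "F = (\<lambda>z. 1 + z ^ n * L z)"
  define P where "P = (\<lambda>z. 1 + z ^ n * (L z + H z))"
  define T where "T = (\<lambda>z. z ^ n * (of_real \<alpha> * H z + g z))"
  have wH: "radial_weight (\<lambda>r. r powr (real n - \<alpha>)) (real n + 1 - \<alpha>)"
    using radial_weight_powr[of "real n - \<alpha>"] assms by (simp add: algebra_simps)
  have wL: "radial_weight (\<lambda>s. s ^ (n - 1)) (real n)"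
    using radial_weight_power[of "n - 1"] assms(1) by (simp add: of_nat_diff)
  have hol_H: "H holomorphic_on \<D>"
    unfolding H_def by (rule holomorphic_radial_average[OF wH assms(5)])
  have hol_L: "L holomorphic_on \<D>"
    unfolding L_def by (rule holomorphic_radial_average[OF wL hol_H])
  have ode_H: "z * deriv H z = g z - (of_nat n + 1 - of_real \<alpha>) * H z" if "z \<in> \<D>" for z
    using radial_average_ode[OF wH assms(5) that] unfolding H_def[symmetric] by (simp add: algebra_simps)
  have ode_L: "z * deriv L z = H z - of_nat n * L z" if "z \<in> \<D>" for z
    using radial_average_ode[OF wL hol_H that] unfolding L_def[symmetric] by (simp add: algebra_simps)
  define f where "f = (\<lambda>z. z + z ^ (n + 1) *
           integral {0..1::real} (\<lambda>s. integral {0..1::real} (\<lambda>r.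
             g (of_real r * of_real s * z) * of_real (r powr (real n - \<alpha>)) * of_real (s ^ (n - 1)))))"
  have f_eq: "f = (\<lambda>z. z * F z)"
  proof
    fix z
    have "f z = z + z ^ (n + 1) * L z"
      \<comment> \<open>The factor \<open>s ^ (n - 1)\<close> is constant in \<open>r\<close> and
        leaves the inner integral.\<close>
      by (simp only: f_def L_def H_def radial_average_def mult.assoc[of _ _ z]
            Henstock_Kurzweil_Integration.integral_mult_left)
    then show "f z = z * F z"
      by (simp add: F_def algebra_simps)
  qed
  have z_power: "z * (of_nat n * z ^ (n - 1)) = of_nat n * z ^ n" for z :: complex
    using assms(1) by (cases n) auto
  have df: "(f has_field_derivative P z) (at z)" if z: "z \<in> \<D>" for z
  proof -
    have "(f has_field_derivative F z + z * (of_nat n * z ^ (n - 1) * L z + z ^ n * deriv L z)) (at z)"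
      unfolding f_eq F_def
      by (rule derivative_eq_intros refl holomorphic_derivI[OF hol_L open_ball z] | simp)+
    \<comment> \<open>Regrouping exposes \<open>z * deriv L z\<close>, which \<open>ode_L\<close>
      replaces without any division by \<open>z\<close>.\<close>
    also have "F z + z * (of_nat n * z ^ (n - 1) * L z + z ^ n * deriv L z)
        = F z + (z * (of_nat n * z ^ (n - 1)) * L z + z ^ n * (z * deriv L z))"
      by (simp add: algebra_simps)
    also have "\<dots> = P z"
      unfolding z_power ode_L[OF z] by (simp add: F_def P_def algebra_simps)
    finally show ?thesis .
  qed
  have deriv_f: "deriv f z = P z" if "z \<in> \<D>" for z
    using df[OF that] by (rule DERIV_imp_deriv)
  have ddf: "z * deriv (deriv f) z = T z" if z: "z \<in> \<D>" for z
  proof -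
    have "deriv (deriv f) z = deriv P z"
      using eventually_nhds_in_open[OF open_ball z] deriv_f
      by (intro deriv_cong_ev refl) (auto elim: eventually_mono)
    also have "\<dots> = of_nat n * z ^ (n - 1) * (L z + H z) + z ^ n * (deriv L z + deriv H z)"
      unfolding P_def
      by (rule DERIV_imp_deriv)
         (rule derivative_eq_intros refl holomorphic_derivI[OF hol_L open_ball z]
            holomorphic_derivI[OF hol_H open_ball z] | simp)+
    also have "z * \<dots> = z * (of_nat n * z ^ (n - 1)) * (L z + H z) + z ^ n * (z * deriv L z + z * deriv H z)"
      by (simp add: algebra_simps)
    also have "\<dots> = T z"
      unfolding z_power ode_L[OF z] ode_H[OF z] by (simp add: T_def algebra_simps)
    finally show ?thesis .
  qed
  have estimates: "P z \<noteq> 0 \<and> F z \<noteq> 0 \<and>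
      cmod ((1 - of_real \<alpha> + of_real \<alpha> * (T z / P z)) / (P z / F z) - (1 - of_real \<alpha>)) < lam"
    if z: "z \<in> \<D>" for z
  proof -
    define \<rho> where "\<rho> = cmod z"
    have \<rho>: "\<rho> < 1" "z \<in> cball 0 \<rho>" "cball 0 \<rho> \<subseteq> \<D>" using z by (auto simp: \<rho>_def)
    have cg: "continuous_on \<D> g" and cH: "continuous_on \<D> H"
      using assms(5) hol_H by (auto intro: holomorphic_on_imp_continuous_on)
    \<comment> \<open>The supremum of the modulus of \<open>g\<close> over \<open>\<D>\<close> may
      equal \<open>\<delta>\<close>; on a compact disc the maximum is attained, hence strictly
      smaller.\<close>
    have "\<exists>x\<in>cball 0 \<rho>. \<forall>u\<in>cball 0 \<rho>. cmod (g u) \<le> cmod (g x)"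
      using \<rho> by (intro continuous_attains_sup continuous_on_norm continuous_on_subset[OF cg])
        (auto simp: \<rho>_def)
    then obtain x where x: "x \<in> cball 0 \<rho>" "\<And>u. u \<in> cball 0 \<rho> \<Longrightarrow> cmod (g u) \<le> cmod (g x)"
      by blast
    define c where "c = real n * (real n + 1 - \<alpha>)"
    define y where "y = cmod (g x) / c"
    have c: "c > 0" and \<alpha>n: "real n + 1 - \<alpha> > 0" using assms by (auto simp: c_def)
    have y0: "0 \<le> y" using c by (simp add: y_def)
    have cy: "c * y = cmod (g x)" using c by (simp add: y_def)
    have "c * y < \<delta>" using cy x \<rho> assms(7) by auto
    note root = phi_neg_imp_lt_one[OF assms(1-4,6) y0 this[unfolded c_def]]
    have g_le: "cmod (g u) \<le> c * y" if "u \<in> cball 0 \<rho>" for u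
      using x(2)[OF that] cy by simp
    \<comment> \<open>Each average divides by its weight constant: \<open>c * y\<close> becomes
      \<open>n * y\<close> for \<open>H\<close>, then \<open>y\<close> for \<open>L\<close>. The
      bound on \<open>H\<close> is needed on the whole disc because \<open>L\<close> averages
      \<open>H\<close>.\<close>
    have H_le: "cmod (H u) \<le> real n * y" if "u \<in> cball 0 \<rho>" for u
      using norm_radial_average_le[OF wH cg \<rho>(1) that g_le] \<alpha>n by (simp add: H_def c_def)
    have L_le: "cmod (L z) \<le> y"
      using norm_radial_average_le[OF wL cH \<rho>(1,2) H_le] assms(1) by (simp add: L_def)
    have zn: "cmod (z ^ n) \<le> 1"
      using z by (simp add: norm_power power_le_one)
    have zn_mult: "cmod (z ^ n * u) \<le> b" if "cmod u \<le> b" for u b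
      using mult_mono[OF zn that] by (simp add: norm_mult)
    have "cmod (F z - 1) \<le> y"
      unfolding F_def using zn_mult[OF L_le] by simp
    moreover have "cmod (F z - P z) \<le> real n * y"
      using zn_mult[OF H_le[OF \<rho>(2)]] by (simp add: F_def P_def norm_minus_commute algebra_simps)
    moreover have "cmod (P z - 1) \<le> (real n + 1) * y"
      unfolding P_def using zn_mult[of "L z + H z" "(real n + 1) * y"]
        norm_triangle_mono[OF L_le H_le[OF \<rho>(2)]] by (simp add: algebra_simps)
    moreover have "cmod (T z) \<le> real n * (real n + 1) * y"
    proof -
      have "cmod (of_real \<alpha> * H z + g z) \<le> \<alpha> * (real n * y) + c * y"
        using H_le[OF \<rho>(2)] g_le[OF \<rho>(2)] assms(2)
        by (intro norm_triangle_mono) (auto simp: norm_mult intro: mult_left_mono)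
      \<comment> \<open>The terms in \<open>\<alpha>\<close> cancel, since
        \<open>c = n (n + 1 - \<alpha>)\<close>.\<close>
      also have "\<dots> = real n * (real n + 1) * y" by (simp add: c_def algebra_simps)
      finally show ?thesis unfolding T_def by (rule zn_mult)
    qed
    moreover have "(1 - \<alpha>) * (real n * y) * (1 - (real n + 1) * y)
        + \<alpha> * (1 + y) * (real n * (real n + 1) * y) < lam * (1 - (real n + 1) * y)\<^sup>2"
      using root(1) c unfolding phi_scaled by (simp add: c_def[symmetric] mult_less_0_iff)
    \<comment> \<open>With \<open>cmod (F z - 1) \<le> y\<close> this excludes zeros of
      \<open>F\<close>; \<open>root(2)\<close> does the same for \<open>P\<close>.\<close>
    moreover have "y < 1"
      using root(2) mult_right_mono[of 1 "real n + 1" y] y0 by linarith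
    ultimately show ?thesis
      using class_G_estimate[OF assms(2,3) of_nat_0_le_iff y0 root(2), of "F z" "P z" "T z" lam] root(2)
      by (cases "P z = 0 \<or> F z = 0") auto
  qed
  have "f holomorphic_on \<D>"
    using df by (meson field_differentiable_at_within field_differentiable_def holomorphic_on_def)
  moreover have "f 0 = 0" "deriv f 0 = 1"
    using deriv_f[of 0] assms(1) by (simp_all add: f_eq P_def)
  ultimately have A: "f \<in> class_A"
    by (simp add: class_A_def)
  have quot: "log_deriv_quot f z = P z / F z" if "z \<in> \<D>" for z
  proof (cases "z = 0")
    \<comment> \<open>As \<open>n \<ge> 1\<close>, both \<open>P\<close> and \<open>F\<close> equal
      1 at 0, in agreement with the limiting value of the quotient.\<close>
    case True
    then show ?thesis
      using log_deriv_quot_0[OF A] assms(1) by (simp add: P_def F_def power_0_left)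
  next
    case False
    then show ?thesis
      using deriv_f[OF that] by (simp add: log_deriv_quot_def f_eq)
  qed
  have "f \<in> class_G lam \<alpha>"
    unfolding class_G_def
  proof (intro CollectI conjI ballI A)
    fix z assume z: "z \<in> \<D>"
    show "deriv f z \<noteq> 0"
      using estimates[OF z] deriv_f[OF z] by simp
    show "cmod ((1 - of_real \<alpha> + of_real \<alpha> * (z * deriv (deriv f) z / deriv f z))
            / log_deriv_quot f z - (1 - of_real \<alpha>)) < lam"
      using estimates[OF z] unfolding ddf[OF z] deriv_f[OF z] quot[OF z] by blast
  next
    fix z assume z: "z \<in> \<D> - {0}"
    then show "f z \<noteq> 0"
      using estimates[of z] by (simp add: f_eq)
  qed
  then show ?thesis
    by (simp only: f_def)
qed

end
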